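(* Let $(P,\leq,1)$ be a finite poset with top element $1$ having pseudocomplemented sections, and for $x,y\in P$ put $x\rightarrow y:=\{z^y\mid z\in\operatorname{Min}U(x,y)\}$. Then $(P,\rightarrow,1)$ is a finite I-algebra.
   Context: For $A\subseteq P$ let $L(A)=\{x\in P\mid x\leq a\ \forall a\in A\}$, $U(A)=\{x\in P\mid a\leq x\ \forall a\in A\}$, $L(a,b)=L(\{a,b\})$, and $\operatorname{Min}A$ the set of minimal elements of $A$. For $y\in P$, $[y,1]=\{x\in P\mid y\leq x\leq 1\}$. A finite poset $(P,\leq,1)$ with top $1$ has pseudocomplemented sections if for every $y\in P$ and $x\in[y,1]$ there is a greatest element $x^y$ of $[y,1]$ with $L(x,x^y)\cap[y,1]=\{y\}$. A finite I-algebra is a triple $(A,\rightarrow,1)$ with $A$ a finite set, $1\in A$, and $\rightarrow$ a map from $A^2$ to the nonempty subsets of $A$, such that for all $x,y,z,u\in A$ (writing "$p\rightarrow q=1$" for $p\rightarrow q=\{1\}$, and "$z\rightarrow(x\rightarrow y)=1$" for "$z\rightarrow w=\{1\}$ for every $w\in x\rightarrow y$"): (I1) $x\rightarrow x=x\rightarrow 1=\{1\}$; (I2) if $x\rightarrow y=y\rightarrow x=1$ then $x=y$; (I3) if $x\rightarrow y=y\rightarrow z=1$ then $x\rightarrow z=1$; (I4) if $y\rightarrow z=z\rightarrow x=1$ and $z\rightarrow(x\rightarrow y)=1$ then $z=y$; (I5) if $y\rightarrow x=y\rightarrow u=1$ and [for every $z\in A$, $y\rightarrow z=z\rightarrow x=z\rightarrow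 u=1$ implies $z=y$], then $u\rightarrow(x\rightarrow y)=1$; (I6) $x\rightarrow y=\bigcup\{z\rightarrow y\mid z\in A,\ x\rightarrow z=y\rightarrow z=1,\text{ and for all }u\in A,\ (x\rightarrow u=y\rightarrow u=u\rightarrow z=1\Rightarrow u=z)\}$. *)

theory Defs
  imports "HOL-Algebra.Order"
begin

text \<open>
  A poset with top is a partial order \<open>P\<close> with explicit carrier, together with an element \<open>e\<close>
  satisfying \<^term>\<open>greatest P e (carrier P)\<close>. The cones \<open>L(A)\<close> and \<open>U(A)\<close> are
  \<^term>\<open>Lower P A\<close> and \<^term>\<open>Upper P A\<close>, and \<open>[y,1]\<close> is \<^term>\<open>\<lbrace>y..e\<rbrace>\<^bsub>P\<^esub>\<close>.
\<close>

definition minimal_elements :: "('a, 'b) gorder_scheme \<Rightarrow> 'a set \<Rightarrow> 'a set" where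
  "minimal_elements P A = {m \<in> A. \<forall>a\<in>A. a \<sqsubseteq>\<^bsub>P\<^esub> m \<longrightarrow> a = m}"

definition is_sectional_pseudocomplement ::
    "('a, 'b) gorder_scheme \<Rightarrow> 'a \<Rightarrow> 'a \<Rightarrow> 'a \<Rightarrow> 'a \<Rightarrow> bool" where
  "is_sectional_pseudocomplement P e x y g \<longleftrightarrow>
     greatest P g {z \<in> \<lbrace>y..e\<rbrace>\<^bsub>P\<^esub>. Lower P {x, z} \<inter> \<lbrace>y..e\<rbrace>\<^bsub>P\<^esub> = {y}}"

definition has_pseudocomplemented_sections :: "('a, 'b) gorder_scheme \<Rightarrow> 'a \<Rightarrow> bool" where
  "has_pseudocomplemented_sections P e \<longleftrightarrow>
     (\<forall>y\<in>carrier P. \<forall>x\<in>\<lbrace>y..e\<rbrace>\<^bsub>P\<^esub>. \<exists>g. is_sectional_pseudocomplement P e x y g)"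

text \<open>
  \<open>sectional_pseudocomplement P e x y\<close> is \<open>x\<^sup>y\<close>. It is meaningful only for \<open>y \<sqsubseteq> x\<close>, which always
  holds where \<open>sectional_arrow\<close> uses it.
\<close>

definition sectional_pseudocomplement ::
    "('a, 'b) gorder_scheme \<Rightarrow> 'a \<Rightarrow> 'a \<Rightarrow> 'a \<Rightarrow> 'a" where
  "sectional_pseudocomplement P e x y = (THE g. is_sectional_pseudocomplement P e x y g)"

definition sectional_arrow :: "('a, 'b) gorder_scheme \<Rightarrow> 'a \<Rightarrow> 'a \<Rightarrow> 'a \<Rightarrow> 'a set" where
  "sectional_arrow P e x y =
     {sectional_pseudocomplement P e z y | z. z \<in> minimal_elements P (Upper P {x, y})}"

text \<open>
  The operation is a total function on the type, but it is only constrained, and only applied,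
  on the carrier \<open>A\<close>. The premise \<open>z \<rightarrow> (x \<rightarrow> y) = 1\<close> of \<open>I4\<close> and the conclusion
  \<open>u \<rightarrow> (x \<rightarrow> y) = 1\<close> of \<open>I5\<close> are elementwise statements about the set \<open>x \<rightarrow> y\<close>.
\<close>

locale finite_I_algebra =
  fixes A :: "'a set"
    and arr :: "'a \<Rightarrow> 'a \<Rightarrow> 'a set"  (infixr "\<leadsto>" 60)
    and e :: 'a
  assumes finite_carrier: "finite A"
    and one_in: "e \<in> A"
    and arr_closed: "\<lbrakk>x \<in> A; y \<in> A\<rbrakk> \<Longrightarrow> x \<leadsto> y \<subseteq> A"
    and arr_nonempty: "\<lbrakk>x \<in> A; y \<in> A\<rbrakk> \<Longrightarrow> x \<leadsto> y \<noteq> {}"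
    and I1: "x \<in> A \<Longrightarrow> x \<leadsto> x = {e} \<and> x \<leadsto> e = {e}"
    and I2: "\<lbrakk>x \<in> A; y \<in> A; x \<leadsto> y = {e}; y \<leadsto> x = {e}\<rbrakk> \<Longrightarrow> x = y"
    and I3: "\<lbrakk>x \<in> A; y \<in> A; z \<in> A; x \<leadsto> y = {e}; y \<leadsto> z = {e}\<rbrakk> \<Longrightarrow> x \<leadsto> z = {e}"
    and I4: "\<lbrakk>x \<in> A; y \<in> A; z \<in> A; y \<leadsto> z = {e}; z \<leadsto> x = {e};
              \<forall>w \<in> x \<leadsto> y. z \<leadsto> w = {e}\<rbrakk> \<Longrightarrow> z = y"
    and I5: "\<lbrakk>x \<in> A; y \<in> A; u \<in> A; y \<leadsto> x = {e}; y \<leadsto> u = {e};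
              \<forall>z\<in>A. y \<leadsto> z = {e} \<and> z \<leadsto> x = {e} \<and> z \<leadsto> u = {e} \<longrightarrow> z = y\<rbrakk>
             \<Longrightarrow> \<forall>w \<in> x \<leadsto> y. u \<leadsto> w = {e}"
    and I6: "\<lbrakk>x \<in> A; y \<in> A\<rbrakk> \<Longrightarrow>
              x \<leadsto> y = \<Union>{z \<leadsto> y | z. z \<in> A \<and> x \<leadsto> z = {e} \<and> y \<leadsto> z = {e} \<and>
                (\<forall>u\<in>A. x \<leadsto> u = {e} \<and> y \<leadsto> u = {e} \<and> u \<leadsto> z = {e} \<longrightarrow> u = z)}"

end

theory Submission
  imports Defs
begin

text \<open>
  The order is recovered from the arrow: \<open>x \<rightarrow> y = {1}\<close> iff \<open>x \<sqsubseteq> y\<close>. Indeed, \<open>z\<^sup>y = 1\<close> for a minimal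
  upper bound \<open>z\<close> of \<open>x, y\<close> forces \<open>z\<close>, being below both \<open>z\<close> and \<open>z\<^sup>y\<close>, to equal \<open>y\<close>. Under this
  translation I4 and I5 say that \<open>x\<^sup>y\<close> is disjoint from \<open>x\<close> in \<open>[y,1]\<close> and is the greatest such
  element, and I6 holds since \<open>z \<rightarrow> y = {z\<^sup>y}\<close> for \<open>y \<sqsubseteq> z\<close>.
\<close>

context partial_order
begin

lemma sectional_pseudocomplement_equality:
  assumes "is_sectional_pseudocomplement L e x y g"
  shows "sectional_pseudocomplement L e x y = g"
  using assms greatest_unique
  unfolding is_sectional_pseudocomplement_def sectional_pseudocomplement_def
  by blast

lemma sectional_pseudocomplement_exists:
  assumes "has_pseudocomplemented_sections L e" "greatest L e (carrier L)"
    and "y \<in> carrier L" "x \<in> carrier L" "y \<sqsubseteq> x"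
  shows "is_sectional_pseudocomplement L e x y (sectional_pseudocomplement L e x y)"
proof -
  have "x \<in> \<lbrace>y..e\<rbrace>"
    using assms by (auto simp: at_least_at_most_def greatest_def)
  then obtain g where "is_sectional_pseudocomplement L e x y g"
    using assms unfolding has_pseudocomplemented_sections_def by blast
  then show ?thesis
    by (simp add: sectional_pseudocomplement_equality)
qed

lemma sectional_pseudocomplement_closed:
  assumes "is_sectional_pseudocomplement L e x y g"
  shows "g \<in> carrier L"
  using assms by (auto simp: is_sectional_pseudocomplement_def at_least_at_most_def greatest_def)

text \<open>Since \<open>e\<close> is the top, any \<open>z\<close> above \<open>y\<close> lies in
  the section, so a common lower bound of \<open>x\<close> and \<open>g\<close> there can only be
  \<open>y\<close>. This elementwise form fits the premises of I4.\<close>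

lemma sectional_pseudocomplement_disjoint:
  assumes "is_sectional_pseudocomplement L e x y g" "greatest L e (carrier L)" "y \<in> carrier L"
    and "z \<in> carrier L" "y \<sqsubseteq> z" "z \<sqsubseteq> x" "z \<sqsubseteq> g"
  shows "z = y"
proof -
  have "Lower L {x, g} \<inter> \<lbrace>y..e\<rbrace> = {y}"
    using assms(1) by (auto simp: is_sectional_pseudocomplement_def greatest_def)
  moreover have "z \<in> Lower L {x, g} \<inter> \<lbrace>y..e\<rbrace>"
    using assms by (auto simp: Lower_def at_least_at_most_def greatest_def)
  ultimately show ?thesis by blast
qed

text \<open>The hypothesis \<open>disj\<close>, read elementwise as in I5, puts \<open>u\<close>
  among the candidates of which \<open>g\<close> is the greatest.\<close>

lemma le_sectional_pseudocomplement:
  assumes "is_sectional_pseudocomplement L e x y g" "greatest L e (carrier L)"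
    and "x \<in> carrier L" "y \<in> carrier L" "u \<in> carrier L" "y \<sqsubseteq> x" "y \<sqsubseteq> u"
    and disj: "\<And>z. \<lbrakk>z \<in> carrier L; y \<sqsubseteq> z; z \<sqsubseteq> x; z \<sqsubseteq> u\<rbrakk> \<Longrightarrow> z = y"
  shows "u \<sqsubseteq> g"
proof -
  have "Lower L {x, u} \<inter> \<lbrace>y..e\<rbrace> = {y}"
    using assms(2-) by (auto simp: Lower_def at_least_at_most_def greatest_def)
  moreover have "u \<in> \<lbrace>y..e\<rbrace>"
    using assms by (auto simp: at_least_at_most_def greatest_def)
  ultimately show ?thesis
    using assms(1) by (auto simp: is_sectional_pseudocomplement_def greatest_def Upper_def)
qed

text \<open>An element below \<open>y\<close> and in the section above \<open>y\<close> is
  \<open>y\<close> itself, so every member of the section is a candidate and the greatest candidate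
  is \<open>e\<close>.\<close>

lemma sectional_pseudocomplement_self:
  assumes "greatest L e (carrier L)" "y \<in> carrier L"
  shows "is_sectional_pseudocomplement L e y y e"
  using assms
  by (auto simp: is_sectional_pseudocomplement_def greatest_def at_least_at_most_def
      Lower_def Upper_def)

text \<open>The right-hand side uses only the order on the carrier, so rewriting each comparison as
  an arrow equal to \<open>{e}\<close> turns it into the side condition of I6.\<close>

lemma minimal_elements_Upper_iff:
  assumes "x \<in> carrier L" "y \<in> carrier L"
  shows "z \<in> minimal_elements L (Upper L {x, y}) \<longleftrightarrow>
    z \<in> carrier L \<and> x \<sqsubseteq> z \<and> y \<sqsubseteq> z \<and>
    (\<forall>u\<in>carrier L. x \<sqsubseteq> u \<and> y \<sqsubseteq> u \<and> u \<sqsubseteq> z \<longrightarrow> u = z)"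
  using assms by (auto simp: minimal_elements_def Upper_def)

text \<open>Induction on the finite set: a new element \<open>x\<close> below an old minimal element
  \<open>m\<close> becomes minimal, because anything of \<open>A\<close> below \<open>x\<close> is
  below \<open>m\<close> and hence equals \<open>m\<close>; otherwise \<open>m\<close> stays
  minimal.\<close>

lemma minimal_elements_nonempty:
  assumes "finite A" "A \<noteq> {}" "A \<subseteq> carrier L"
  shows "minimal_elements L A \<noteq> {}"
  using assms
proof (induction A rule: finite_ne_induct)
  case (singleton x)
  then show ?case by (auto simp: minimal_elements_def)
next
  case (insert x A)
  then obtain m where m: "m \<in> A" "\<forall>a\<in>A. a \<sqsubseteq> m \<longrightarrow> a = m"
    by (auto simp: minimal_elements_def)
  show ?case
  proof (cases "x \<sqsubseteq> m")
    case True
    have "a = x" if a: "a \<in> A" "a \<sqsubseteq> x" for a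
    proof -
      have c: "a \<in> carrier L" "x \<in> carrier L" "m \<in> carrier L"
        using a m insert.prems by auto
      have "a = m"
        using m a le_trans[OF a(2) True c] by blast
      then show "a = x"
        using le_antisym[OF a(2) _ c(1,2)] True by simp
    qed
    then have "x \<in> minimal_elements L (insert x A)"
      by (auto simp: minimal_elements_def)
    then show ?thesis by blast
  next
    case False
    then have "m \<in> minimal_elements L (insert x A)"
      using m by (auto simp: minimal_elements_def)
    then show ?thesis by blast
  qed
qed

text \<open>Here \<open>x\<close> is the least upper bound of the pair, hence its only minimal one.
  The elementwise conditions in I4 and I5 thereby concern a single pseudocomplement.\<close>

lemma sectional_arrow_of_ge:
  assumes "x \<in> carrier L" "y \<in> carrier L" "y \<sqsubseteq> x"
  shows "sectional_arrow L e x y = {sectional_pseudocomplement L e x y}"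
proof -
  have "z \<in> minimal_elements L (Upper L {x, y}) \<longleftrightarrow> z = x" for z
    unfolding minimal_elements_Upper_iff[OF assms(1,2)] using assms le_refl by blast
  then show ?thesis by (simp add: sectional_arrow_def)
qed

text \<open>The top \<open>e\<close> is an upper bound of the pair, and a nonempty finite set of
  upper bounds has a minimal member.\<close>

lemma sectional_arrow_nonempty:
  assumes "finite (carrier L)" "greatest L e (carrier L)" "x \<in> carrier L" "y \<in> carrier L"
  shows "sectional_arrow L e x y \<noteq> {}"
proof -
  have "e \<in> Upper L {x, y}"
    using assms by (auto simp: greatest_def Upper_def)
  then have "minimal_elements L (Upper L {x, y}) \<noteq> {}"
    using assms finite_subset[OF Upper_closed] by (intro minimal_elements_nonempty) auto
  then show ?thesis by (auto simp: sectional_arrow_def)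
qed

lemma sectional_arrow_eq_top_iff:
  assumes "finite (carrier L)" "greatest L e (carrier L)" "has_pseudocomplemented_sections L e"
    and "x \<in> carrier L" "y \<in> carrier L"
  shows "sectional_arrow L e x y = {e} \<longleftrightarrow> x \<sqsubseteq> y"
proof
  assume "x \<sqsubseteq> y"
  \<comment> \<open>Now \<open>y\<close> is the only minimal upper bound, so the arrow consists of
    the pseudocomplement of \<open>y\<close> in its own section, which is \<open>e\<close>.\<close>
  then have "z \<in> minimal_elements L (Upper L {x, y}) \<longleftrightarrow> z = y" for z
    unfolding minimal_elements_Upper_iff[OF assms(4,5)] using assms le_refl by blast
  then show "sectional_arrow L e x y = {e}"
    using sectional_pseudocomplement_equality[OF sectional_pseudocomplement_self] assms
    by (simp add: sectional_arrow_def)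
next
  assume top: "sectional_arrow L e x y = {e}"
  then obtain z where z: "z \<in> minimal_elements L (Upper L {x, y})"
      and "sectional_pseudocomplement L e z y = e"
    unfolding sectional_arrow_def by blast
  moreover have zc: "z \<in> carrier L" "x \<sqsubseteq> z" "y \<sqsubseteq> z"
    using z assms minimal_elements_Upper_iff by auto
  ultimately have pc: "is_sectional_pseudocomplement L e z y e"
    using sectional_pseudocomplement_exists[OF assms(3,2,5)] by metis
  have "z = y"
    using sectional_pseudocomplement_disjoint[OF pc assms(2,5)] zc greatest_le[OF assms(2)]
    by simp
  with zc show "x \<sqsubseteq> y" by simp
qed

end

theorem theorem1:
  fixes P :: "('a, 'b) gorder_scheme" and e :: 'a
  assumes "partial_order P"
    and "finite (carrier P)"
    and "greatest P e (carrier P)"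
    and "has_pseudocomplemented_sections P e"
  shows "finite_I_algebra (carrier P) (sectional_arrow P e) e"
proof -
  interpret partial_order P by fact
  note top_iff = sectional_arrow_eq_top_iff[OF assms(2-4)]
  note pc = sectional_pseudocomplement_exists[OF assms(4,3)]
  have e: "e \<in> carrier P" and le_e: "\<And>x. x \<in> carrier P \<Longrightarrow> x \<sqsubseteq>\<^bsub>P\<^esub> e"
    using assms(3) by (auto simp: greatest_def)
  have closed: "sectional_arrow P e x y \<subseteq> carrier P"
    if "x \<in> carrier P" "y \<in> carrier P" for x y
    using that sectional_pseudocomplement_closed[OF pc]
    by (auto simp: sectional_arrow_def minimal_elements_Upper_iff)
  show ?thesis
  proof
    show "finite (carrier P)" "e \<in> carrier P" by fact+
  next
    fix x y assume "x \<in> carrier P" "y \<in> carrier P"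
    then show "sectional_arrow P e x y \<subseteq> carrier P" "sectional_arrow P e x y \<noteq> {}"
      using closed sectional_arrow_nonempty assms by auto
  next
    fix x assume "x \<in> carrier P"
    then show "sectional_arrow P e x x = {e} \<and> sectional_arrow P e x e = {e}"
      using e le_e by (simp add: top_iff)
  next
    fix x y assume "x \<in> carrier P" "y \<in> carrier P"
      "sectional_arrow P e x y = {e}" "sectional_arrow P e y x = {e}"
    then show "x = y" using le_antisym by (simp add: top_iff)
  next
    fix x y z assume "x \<in> carrier P" "y \<in> carrier P" "z \<in> carrier P"
      "sectional_arrow P e x y = {e}" "sectional_arrow P e y z = {e}"
    then show "sectional_arrow P e x z = {e}" using le_trans by (simp add: top_iff)
  next
    fix x y z assume c: "x \<in> carrier P" "y \<in> carrier P" "z \<in> carrier P"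
      and le: "sectional_arrow P e y z = {e}" "sectional_arrow P e z x = {e}"
      and w: "\<forall>w\<in>sectional_arrow P e x y. sectional_arrow P e z w = {e}"
    \<comment> \<open>The third inequality, by transitivity through \<open>z\<close>, makes the
      arrow from \<open>x\<close> to \<open>y\<close> a singleton, so that the premise
      \<open>w\<close> bounds \<open>z\<close> by the pseudocomplement.\<close>
    have le': "y \<sqsubseteq>\<^bsub>P\<^esub> z" "z \<sqsubseteq>\<^bsub>P\<^esub> x" "y \<sqsubseteq>\<^bsub>P\<^esub> x"
      using le c le_trans by (auto simp: top_iff)
    have g: "is_sectional_pseudocomplement P e x y (sectional_pseudocomplement P e x y)"
      using pc c le' by blast
    have "z \<sqsubseteq>\<^bsub>P\<^esub> sectional_pseudocomplement P e x y"
      using w c le' sectional_pseudocomplement_closed[OF g]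
      by (simp add: sectional_arrow_of_ge top_iff)
    then show "z = y"
      using sectional_pseudocomplement_disjoint[OF g] assms c le' by blast
  next
    fix x y u assume c: "x \<in> carrier P" "y \<in> carrier P" "u \<in> carrier P"
      and le: "sectional_arrow P e y x = {e}" "sectional_arrow P e y u = {e}"
      and disj: "\<forall>z\<in>carrier P. sectional_arrow P e y z = {e} \<and> sectional_arrow P e z x = {e} \<and>
        sectional_arrow P e z u = {e} \<longrightarrow> z = y"
    have le': "y \<sqsubseteq>\<^bsub>P\<^esub> x" "y \<sqsubseteq>\<^bsub>P\<^esub> u"
      using le c by (auto simp: top_iff)
    have g: "is_sectional_pseudocomplement P e x y (sectional_pseudocomplement P e x y)"
      using pc c le' by blast
    have "u \<sqsubseteq>\<^bsub>P\<^esub> sectional_pseudocomplement P e x y"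
      using disj c le' by (intro le_sectional_pseudocomplement[OF g assms(3)]) (auto simp: top_iff)
    then show "\<forall>w\<in>sectional_arrow P e x y. sectional_arrow P e u w = {e}"
      using c le' sectional_pseudocomplement_closed[OF g]
      by (simp add: sectional_arrow_of_ge top_iff)
  next
    fix x y assume c: "x \<in> carrier P" "y \<in> carrier P"
    let ?M = "minimal_elements P (Upper P {x, y})"
    \<comment> \<open>The index set of the union in I6 is the set of minimal upper bounds. The
      congruence rules hand the simplifier the carrier membership of \<open>z\<close> and
      \<open>u\<close> that \<open>top_iff\<close> requires.\<close>
    have M: "?M = {z. z \<in> carrier P \<and> sectional_arrow P e x z = {e} \<and>
        sectional_arrow P e y z = {e} \<and>
        (\<forall>u\<in>carrier P. sectional_arrow P e x u = {e} \<and> sectional_arrow P e y u = {e} \<and>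
          sectional_arrow P e u z = {e} \<longrightarrow> u = z)}"
      by (rule Set.set_eqI)
        (simp add: c minimal_elements_Upper_iff top_iff cong: conj_cong ball_cong)
    have "sectional_arrow P e z y = {sectional_pseudocomplement P e z y}" if "z \<in> ?M" for z
      using that c by (simp add: minimal_elements_Upper_iff sectional_arrow_of_ge)
    \<comment> \<open>Each \<open>z\<close> in \<open>?M\<close> contributes exactly one
      pseudocomplement. The definition is unfolded only at \<open>x\<close> and \<open>y\<close>, so
      the arrows under the union keep their form and the previous fact rewrites them.\<close>
    then have "sectional_arrow P e x y = \<Union>{sectional_arrow P e z y | z. z \<in> ?M}"
      unfolding sectional_arrow_def[of P e x y] by fastforce
    then show "sectional_arrow P e x y = \<Union>{sectional_arrow P e z y | z. z \<in> carrier P \<and>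
        sectional_arrow P e x z = {e} \<and> sectional_arrow P e y z = {e} \<and>
        (\<forall>u\<in>carrier P. sectional_arrow P e x u = {e} \<and> sectional_arrow P e y u = {e} \<and>
          sectional_arrow P e u z = {e} \<longrightarrow> u = z)}"
      unfolding M by simp
  qed
qed

end
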